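(* Let $A_0A_1\dots A_n$ be a lattice oriented broken line on unit distance from the origin $O$ with signed length-sine sequence $(a_0,a_1,\dots,a_{2n-2})$, and suppose $A_0=(1,0)$, $A_1=(1,a_0)$ and $A_n=(p,q)$ with $\gcd(p,q)=1$. Then $q/p=\;]a_0,a_1,\dots,a_{2n-2}[$ (as elements of $\mathbb Q\cup\{\infty\}$, with $q/0=\infty$).
   Context: We work in $\mathbb R^2$ with standard orientation and lattice $\mathbb Z^2$. For distinct lattice points $A,B$, $\operatorname{l\ell}(AB)$ is the number of lattice points on segment $AB$ minus one. $\operatorname{sgn}(A,B,C)\in\{1,0,-1\}$ is the sign of $\det(A-B,C-B)$. For an ordinary lattice angle $\angle XYZ$ (lattice points, not collinear, rays $YX$, $YZ$) let $v_1,v_2$ be primitive lattice vectors along $YX$, $YZ$; lattice points $P$ with $(v_1,P-Y)$ a basis form two lines parallel to $YX$; ray $YZ$ meets exactly one, $l$, at $Q$; let $D$ be the lattice point of $l$ nearest $Q$ among those strictly on the other side of line $YZ$ from $X$; writing $v_2=x_1v_1+x_2(D-Y)$, $\operatorname{lsin}\angle XYZ=x_2$. A lattice oriented broken line $A_0\dots A_n$ ($n\ge1$) is a sequence of lattice points with $A_{i-1}\ne A_i$ and no two consecutive segments in a common line; it is on unit distance from a lattice point $V$ if for each $i$ the primitive vector along $A_{i-1}A_i$ and $V-A_{i-1}$ form a basis of $\mathbb Z^2$. Its signed length-sine sequence is $(a_0,\dots,a_{2n-2})$, $a_{2i-2}=\operatorname{sgn}(A_{i-1},V,A_i)\operatorname{l\ell}(A_{i-1}A_i)$,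 $a_{2i-1}=\operatorname{sgn}(A_{i-1},V,A_i)\operatorname{sgn}(A_i,V,A_{i+1})\operatorname{sgn}(A_{i-1},A_i,A_{i+1})\operatorname{lsin}\angle A_{i-1}A_iA_{i+1}$. $\bar{\mathbb Q}=\mathbb Q\cup\{\infty\}$ with $q\pm\infty=\infty$, $1/0=\infty$, $1/\infty=0$; for integers $a_0,\dots,a_k$, $]a_0,\dots,a_k[\;=a_0+1/(a_1+1/(\cdots+1/a_k))\in\bar{\mathbb Q}$. *)

theory Defs
  imports "HOL-Analysis.Analysis"
begin

section \<open>Lattice points in the plane\<close>

type_synonym lattice_point = "int \<times> int"

definition to_plane :: "lattice_point \<Rightarrow> real \<times> real" where
  "to_plane P = (real_of_int (fst P), real_of_int (snd P))"

definition lscale :: "int \<Rightarrow> lattice_point \<Rightarrow> lattice_point" where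
  "lscale k v = (k * fst v, k * snd v)"

definition det2 :: "lattice_point \<Rightarrow> lattice_point \<Rightarrow> int" where
  "det2 u v = fst u * snd v - snd u * fst v"

definition lattice_basis :: "lattice_point \<Rightarrow> lattice_point \<Rightarrow> bool" where
  "lattice_basis u v \<longleftrightarrow>
     (\<forall>w. \<exists>!c :: int \<times> int. w = lscale (fst c) u + lscale (snd c) v)"

definition primitive :: "lattice_point \<Rightarrow> bool" where
  "primitive v \<longleftrightarrow> coprime (fst v) (snd v)"

text \<open>Meaningful only for \<open>A \<noteq> B\<close>.\<close>

definition prim_vec :: "lattice_point \<Rightarrow> lattice_point \<Rightarrow> lattice_point" where
  "prim_vec A B = (THE w. primitive w \<and> (\<exists>k>0. B - A = lscale k w))"

definition lattice_length :: "lattice_point \<Rightarrow> lattice_point \<Rightarrow> int" where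
  "lattice_length A B =
     int (card {P. to_plane P \<in> closed_segment (to_plane A) (to_plane B)}) - 1"

definition sgn3 :: "lattice_point \<Rightarrow> lattice_point \<Rightarrow> lattice_point \<Rightarrow> int" where
  "sgn3 A B C = sgn (det2 (A - B) (C - B))"


section \<open>Lattice sine\<close>

definition plane_ray :: "lattice_point \<Rightarrow> lattice_point \<Rightarrow> (real \<times> real) set" where
  "plane_ray Y Z = {to_plane Y + t *\<^sub>R (to_plane Z - to_plane Y) | t. t \<ge> 0}"

definition plane_line :: "lattice_point \<Rightarrow> lattice_point \<Rightarrow> (real \<times> real) set" where
  "plane_line P v = {to_plane P + t *\<^sub>R to_plane v | t. True}"

text \<open>The two lines parallel to \<open>YX\<close> that carry the lattice points completing
  the primitive vector along \<open>YX\<close> to a basis.\<close>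

definition unit_lines :: "lattice_point \<Rightarrow> lattice_point \<Rightarrow> (real \<times> real) set set" where
  "unit_lines X Y =
     {plane_line P (prim_vec Y X) | P. lattice_basis (prim_vec Y X) (P - Y)}"

text \<open>Two points off the line \<open>YZ\<close> lie on opposite sides of it iff their values of
  \<open>sgn3 _ Y Z\<close> are opposite; \<open>X\<close> is off that line because the angle is ordinary.\<close>

definition lsin_point ::
  "lattice_point \<Rightarrow> lattice_point \<Rightarrow> lattice_point \<Rightarrow> lattice_point \<Rightarrow> bool" where
  "lsin_point X Y Z D \<longleftrightarrow>
     (\<exists>l Q. l \<in> unit_lines X Y \<and> Q \<in> plane_ray Y Z \<inter> l \<and>
        is_arg_min (\<lambda>P. dist (to_plane P) Q)
          (\<lambda>P. to_plane P \<in> l \<and> sgn3 P Y Z = - sgn3 X Y Z) D)"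

text \<open>Meaningful only if \<open>X\<close>, \<open>Y\<close>, \<open>Z\<close> are not collinear.\<close>

definition lsin :: "lattice_point \<Rightarrow> lattice_point \<Rightarrow> lattice_point \<Rightarrow> int" where
  "lsin X Y Z =
     (THE x2. \<exists>D x1. lsin_point X Y Z D \<and>
        prim_vec Y Z = lscale x1 (prim_vec Y X) + lscale x2 (D - Y))"


section \<open>Broken lines\<close>

text \<open>The broken line \<open>A\<^sub>0 \<dots> A\<^sub>n\<close> is given by \<open>n\<close> and the values of \<open>A\<close> on \<open>{0..n}\<close>.\<close>

definition broken_line :: "nat \<Rightarrow> (nat \<Rightarrow> lattice_point) \<Rightarrow> bool" where
  "broken_line n A \<longleftrightarrow> n \<ge> 1 \<and>
     (\<forall>i\<in>{1..n}. A (i - 1) \<noteq> A i) \<and>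
     (\<forall>i\<in>{1..<n}. \<not> collinear {to_plane (A (i - 1)), to_plane (A i), to_plane (A (i + 1))})"

definition on_unit_distance ::
  "lattice_point \<Rightarrow> nat \<Rightarrow> (nat \<Rightarrow> lattice_point) \<Rightarrow> bool" where
  "on_unit_distance V n A \<longleftrightarrow>
     (\<forall>i\<in>{1..n}. lattice_basis (prim_vec (A (i - 1)) (A i)) (V - A (i - 1)))"

definition lsls_even :: "lattice_point \<Rightarrow> (nat \<Rightarrow> lattice_point) \<Rightarrow> nat \<Rightarrow> int" where
  "lsls_even V A i = sgn3 (A (i - 1)) V (A i) * lattice_length (A (i - 1)) (A i)"

definition lsls_odd :: "lattice_point \<Rightarrow> (nat \<Rightarrow> lattice_point) \<Rightarrow> nat \<Rightarrow> int" where
  "lsls_odd V A i =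
     sgn3 (A (i - 1)) V (A i) * sgn3 (A i) V (A (i + 1)) *
     sgn3 (A (i - 1)) (A i) (A (i + 1)) * lsin (A (i - 1)) (A i) (A (i + 1))"

text \<open>Entry \<open>2 * i - 2\<close> is \<open>lsls_even V A i\<close> and entry \<open>2 * i - 1\<close> is \<open>lsls_odd V A i\<close>.\<close>

definition signed_length_sine ::
  "lattice_point \<Rightarrow> nat \<Rightarrow> (nat \<Rightarrow> lattice_point) \<Rightarrow> int list" where
  "signed_length_sine V n A =
     map (\<lambda>k. if even k then lsls_even V A (k div 2 + 1) else lsls_odd V A (k div 2 + 1))
       [0..<2 * n - 1]"


section \<open>Continued fractions with values in the extended rationals\<close>

datatype ext_rat = Fin rat | Infty

fun add_ext :: "rat \<Rightarrow> ext_rat \<Rightarrow> ext_rat" where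
  "add_ext q (Fin r) = Fin (q + r)"
| "add_ext q Infty = Infty"

fun inverse_ext :: "ext_rat \<Rightarrow> ext_rat" where
  "inverse_ext (Fin r) = (if r = 0 then Infty else Fin (1 / r))"
| "inverse_ext Infty = Fin 0"

text \<open>Unspecified on the empty list.\<close>

fun cont_frac :: "int list \<Rightarrow> ext_rat" where
  "cont_frac [a] = Fin (of_int a)"
| "cont_frac (a # b # bs) = add_ext (of_int a) (inverse_ext (cont_frac (b # bs)))"

definition ext_quotient :: "int \<Rightarrow> int \<Rightarrow> ext_rat" where
  "ext_quotient q p = (if p = 0 then Infty else Fin (of_int q / of_int p))"

end

theory Submission
  imports Defs
begin

text \<open>Let \<open>w\<^sub>i\<close> be the primitive vector along \<open>A\<^sub>i\<^sub>-\<^sub>1A\<^sub>i\<close>. Unit distance means that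
  \<open>e\<^sub>i = det (A\<^sub>i\<^sub>-\<^sub>1, w\<^sub>i)\<close> is a sign. Put \<open>u\<^sub>i = e\<^sub>i w\<^sub>i\<close>. Since the lattice sine of an angle is the
  absolute value of the determinant of the primitive vectors along its sides, the signs in the
  length-sine sequence are exactly those for which \<open>A\<^sub>i = A\<^sub>i\<^sub>-\<^sub>1 + a\<^sub>2\<^sub>i\<^sub>-\<^sub>2 u\<^sub>i\<close> and
  \<open>u\<^sub>i\<^sub>+\<^sub>1 = u\<^sub>i + a\<^sub>2\<^sub>i\<^sub>-\<^sub>1 A\<^sub>i\<close>. This is the recurrence of the convergents of a continued fraction, and
  it starts at \<open>A\<^sub>0 = (1, 0)\<close>, \<open>u\<^sub>1 = (0, 1)\<close>.\<close>

section \<open>Determinants and unimodular bases of the lattice\<close>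

lemma to_plane_add: "to_plane (u + v) = to_plane u + to_plane v"
  and to_plane_diff: "to_plane (u - v) = to_plane u - to_plane v"
  and to_plane_lscale: "to_plane (lscale k v) = real_of_int k *\<^sub>R to_plane v"
  by (simp_all add: to_plane_def lscale_def)

lemma inj_to_plane: "to_plane P = to_plane Q \<longleftrightarrow> P = Q"
  by (auto simp: to_plane_def prod_eq_iff)

lemma det2_lscale_left: "det2 (lscale k u) v = k * det2 u v"
  and det2_lscale_right: "det2 u (lscale k v) = k * det2 u v"
  by (simp_all add: det2_def lscale_def algebra_simps)

lemma det2_add_left: "det2 (u + u') v = det2 u v + det2 u' v"
  and det2_add_right: "det2 u (v + v') = det2 u v + det2 u v'"
  and det2_self [simp]: "det2 u u = 0"
  and det2_swap: "det2 u v = - det2 v u"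
  by (simp_all add: det2_def algebra_simps)

text \<open>Cramer's rule without division: a 3 by 3 determinant with a repeated row vanishes, and
  expanding it gives this relation for any three plane vectors.\<close>

lemma det2_cramer: "lscale (det2 u v) w = lscale (det2 w v) u + lscale (det2 u w) v"
  by (simp add: det2_def lscale_def algebra_simps)

text \<open>If the unit vectors are integer combinations of \<open>u\<close> and \<open>v\<close>,
  multiplicativity makes \<open>det2 u v\<close> a divisor of 1. Conversely, if the determinant is
  its own inverse, Cramer's rule yields integer coordinates and forces them.\<close>

lemma lattice_basis_iff_det2: "lattice_basis u v \<longleftrightarrow> \<bar>det2 u v\<bar> = 1"
proof
  assume b: "lattice_basis u v"
  obtain c d where c: "(1, 0) = lscale (fst c) u + lscale (snd c) v"
    and d: "(0, 1) = lscale (fst d) u + lscale (snd d) v"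
    using b unfolding lattice_basis_def by meson
  have "det2 (1, 0) (0, 1) = det2 c d * det2 u v"
    unfolding c d by (simp add: det2_def lscale_def algebra_simps)
  moreover have "det2 (1, 0) (0, 1) = 1"
    by (simp add: det2_def)
  ultimately have "det2 u v dvd 1"
    by (metis dvd_triv_right)
  then show "\<bar>det2 u v\<bar> = 1"
    by simp
next
  assume a: "\<bar>det2 u v\<bar> = 1"
  define e where "e = det2 u v"
  have ee: "e * e = 1"
    using a unfolding e_def by (auto simp: abs_if split: if_splits)
  show "lattice_basis u v"
    unfolding lattice_basis_def
  proof (intro allI ex1I)
    fix w
    have "w = lscale e (lscale (det2 u v) w)"
      using ee by (simp add: lscale_def prod_eq_iff e_def[symmetric] mult.assoc[symmetric])
    also have "\<dots> = lscale (e * det2 w v) u + lscale (e * det2 u w) v"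
      unfolding det2_cramer[of u v w] by (simp add: lscale_def algebra_simps)
    finally show "w = lscale (fst (e * det2 w v, e * det2 u w)) u
        + lscale (snd (e * det2 w v, e * det2 u w)) v"
      by simp
  next
    fix w c
    assume w: "w = lscale (fst c) u + lscale (snd c) v"
    have "det2 w v = fst c * e" "det2 u w = snd c * e"
      unfolding w by (simp_all add: e_def det2_def lscale_def algebra_simps)
    then show "c = (e * det2 w v, e * det2 u w)"
      using ee by (simp add: prod_eq_iff mult.left_commute)
  qed
qed

section \<open>Primitive vectors and lattice length\<close>

lemma primitive_nonzero: "primitive v \<Longrightarrow> v \<noteq> 0"
  by (auto simp: primitive_def)

text \<open>The factor is recovered as the gcd of the coordinates of the scaled vector.\<close>

lemma primitive_lscale_unique:
  assumes "primitive v" "primitive w" "k > 0" "l > 0" "lscale k v = lscale l w"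
  shows "v = w"
proof -
  have "gcd (k * fst v) (k * snd v) = gcd (l * fst w) (l * snd w)"
    using assms(5) by (simp add: lscale_def)
  then have "k = l"
    using assms(1-4) by (simp add: gcd_mult_left primitive_def coprime_iff_gcd_eq_1)
  then show ?thesis
    using assms by (auto simp: lscale_def prod_eq_iff)
qed

lemma prim_vec_eqI:
  assumes "primitive w" "k > 0" "B - A = lscale k w"
  shows "prim_vec A B = w"
  unfolding prim_vec_def
proof (rule the_equality)
  show "primitive w \<and> (\<exists>k>0. B - A = lscale k w)"
    using assms by blast
  show "v = w" if "primitive v \<and> (\<exists>k>0. B - A = lscale k v)" for v
    using that assms primitive_lscale_unique by metis
qed

lemma prim_vec_exists:
  assumes "A \<noteq> B"
  obtains k where "k > 0" "primitive (prim_vec A B)" "B - A = lscale k (prim_vec A B)"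
proof -
  obtain x y where xy: "B - A = (x, y)"
    by (cases "B - A")
  define g where "g = gcd x y"
  have nz: "x \<noteq> 0 \<or> y \<noteq> 0"
    using assms xy by (metis eq_iff_diff_eq_0 zero_prod_def)
  then have g: "g > 0"
    by (simp add: g_def)
  have "primitive (x div g, y div g)"
    using nz unfolding primitive_def g_def by (simp add: div_gcd_coprime)
  moreover have "B - A = lscale g (x div g, y div g)"
    unfolding xy lscale_def by (simp add: g_def)
  ultimately show ?thesis
    using that g prim_vec_eqI by metis
qed

lemma primitive_det2_exists:
  assumes "primitive v"
  obtains w where "det2 v w = d"
proof -
  obtain x y where "x * fst v + y * snd v = gcd (fst v) (snd v)"
    using bezout_int by blast
  then have "det2 v (- y * d, x * d) = d"
    using assms
    by (simp add: det2_def primitive_def coprime_iff_gcd_eq_1)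
       (metis distrib_right mult.assoc mult.commute mult_1)
  then show ?thesis
    using that by blast
qed

text \<open>The lattice points of the segment are exactly \<open>A + lscale j w\<close> for the
  \<open>k + 1\<close> integers \<open>j\<close> from 0 to \<open>k\<close>.\<close>

lemma lattice_length_lscale:
  assumes "primitive w" "k > 0" "B - A = lscale k w"
  shows "lattice_length A B = k"
proof -
  let ?S = "{P. to_plane P \<in> closed_segment (to_plane A) (to_plane B)}"
  let ?f = "\<lambda>j. A + lscale j w"
  have B: "to_plane B = to_plane A + real_of_int k *\<^sub>R to_plane w"
    using assms(3) by (metis add_diff_cancel_left' diff_add_cancel to_plane_diff
        to_plane_lscale)
  have "?S = ?f ` {0..k}"
  proof (intro equalityI subsetI)
    fix P assume "P \<in> ?S"
    then obtain t where t: "0 \<le> t" "t \<le> 1"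
      "to_plane P = (1 - t) *\<^sub>R to_plane A + t *\<^sub>R to_plane B"
      by (auto simp: closed_segment_def)
    define s where "s = t * real_of_int k"
    have P: "to_plane (P - A) = s *\<^sub>R to_plane w"
      unfolding to_plane_diff t(3) B s_def by (simp add: algebra_simps)
    \<comment> \<open>A Bezout functional takes the value 1 at \<open>w\<close>, so evaluating it at
      the lattice vector \<open>P - A = s w\<close> shows that the real parameter \<open>s\<close>
      is an integer.\<close>
    obtain x y where xy: "x * fst w + y * snd w = 1"
      using assms(1) bezout_int unfolding primitive_def coprime_iff_gcd_eq_1 by metis
    define j where "j = x * fst (P - A) + y * snd (P - A)"
    have "real_of_int j = s * real_of_int (x * fst w + y * snd w)"
      using P by (simp add: j_def to_plane_def algebra_simps)
    then have s: "s = real_of_int j"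
      using xy by simp
    have "P - A = lscale j w"
      using P unfolding s to_plane_lscale[symmetric] inj_to_plane .
    then have "P = ?f j"
      by (metis add.commute diff_add_cancel)
    moreover have "0 \<le> s" "s \<le> real_of_int k"
      using t assms(2) by (simp_all add: s_def mult_left_le_one_le)
    ultimately show "P \<in> ?f ` {0..k}"
      unfolding s by auto
  next
    fix P assume "P \<in> ?f ` {0..k}"
    then obtain j where j: "0 \<le> j" "j \<le> k" "P = ?f j"
      by auto
    let ?t = "real_of_int j / real_of_int k"
    have "to_plane P = (1 - ?t) *\<^sub>R to_plane A + ?t *\<^sub>R to_plane B"
      using assms(2) unfolding j(3) B to_plane_add to_plane_lscale
      by (simp add: algebra_simps)
    moreover have "0 \<le> ?t" "?t \<le> 1"
      using j assms(2) by simp_all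
    ultimately show "P \<in> ?S"
      unfolding closed_segment_def by blast
  qed
  moreover have "inj_on ?f {0..k}"
    using primitive_nonzero[OF assms(1)]
    by (auto simp: inj_on_def lscale_def prod_eq_iff)
  ultimately have "card ?S = card {0..k}"
    by (simp add: card_image)
  then show ?thesis
    using assms(2) by (simp add: lattice_length_def)
qed

section \<open>The lattice sine as an absolute determinant\<close>

text \<open>Candidates no farther from \<open>Q\<close> than \<open>P\<close> lie in a bounded box,
  hence are finitely many; a nearest one among them is nearest overall.\<close>

lemma nearest_lattice_point_exists:
  assumes "\<phi> P"
  obtains D where "is_arg_min (\<lambda>P. dist (to_plane P) Q) \<phi> D"
proof -
  let ?d = "\<lambda>P. dist (to_plane P) Q"
  let ?S = "{R. \<phi> R \<and> ?d R \<le> ?d P}"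
  let ?I = "\<lambda>x. {\<lfloor>x - ?d P\<rfloor>..\<lceil>x + ?d P\<rceil>}"
  have "?S \<subseteq> ?I (fst Q) \<times> ?I (snd Q)"
  proof
    fix R assume R: "R \<in> ?S"
    have "\<bar>real_of_int (fst R) - fst Q\<bar> \<le> ?d P" "\<bar>real_of_int (snd R) - snd Q\<bar> \<le> ?d P"
      using R dist_fst_le[of "to_plane R" Q] dist_snd_le[of "to_plane R" Q]
      by (auto simp: to_plane_def dist_real_def)
    then have "fst R \<in> ?I (fst Q)" "snd R \<in> ?I (snd Q)"
      by (auto simp: floor_le_iff le_ceiling_iff)
    then show "R \<in> ?I (fst Q) \<times> ?I (snd Q)"
      by (simp add: mem_Times_iff)
  qed
  then have "finite ?S"
    by (rule finite_subset) simp
  moreover have "?S \<noteq> {}"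
    using assms order_refl by blast
  ultimately obtain D where "is_arg_min ?d (\<lambda>R. R \<in> ?S) D"
    using ex_is_arg_min_if_finite by blast
  then have "is_arg_min ?d \<phi> D"
    unfolding is_arg_min_linorder mem_Collect_eq by (meson linear order_trans)
  then show ?thesis
    using that by blast
qed

lemma parallel_real_multiple:
  fixes v w :: "real \<times> real"
  assumes "v \<noteq> 0" "fst v * snd w = snd v * fst w"
  obtains s where "w = s *\<^sub>R v"
proof (cases "fst v = 0")
  case True
  with assms have "w = (snd w / snd v) *\<^sub>R v"
    by (auto simp: prod_eq_iff)
  then show ?thesis using that by blast
next
  case False
  with assms have "w = (fst w / fst v) *\<^sub>R v"
    by (auto simp: prod_eq_iff field_simps)
  then show ?thesis using that by blast
qed

lemma plane_line_det2:
  assumes "to_plane P \<in> plane_line R v"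
  shows "det2 v (P - Y) = det2 v (R - Y)"
proof -
  obtain t where "to_plane P = to_plane R + t *\<^sub>R to_plane v"
    using assms by (auto simp: plane_line_def)
  then have "real_of_int (det2 v (P - Y)) = real_of_int (det2 v (R - Y))"
    by (simp add: to_plane_def det2_def algebra_simps)
  then show ?thesis
    by simp
qed

text \<open>The determinant with \<open>prim_vec Y X\<close> is constant on the line carrying
  \<open>D\<close>, and unimodularity makes this constant 1 or -1. Since the ray from
  \<open>Y\<close> through \<open>Z\<close> meets that line, the constant has the sign found at
  \<open>Z\<close>.\<close>

lemma lsin_point_det2:
  assumes "lsin_point X Y Z D" "det2 (prim_vec Y X) (Z - Y) \<noteq> 0"
  shows "det2 (prim_vec Y X) (D - Y) = sgn (det2 (prim_vec Y X) (Z - Y))"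
proof -
  let ?v = "prim_vec Y X"
  obtain P Q where P: "lattice_basis ?v (P - Y)"
    and Q: "Q \<in> plane_ray Y Z" "Q \<in> plane_line P ?v" and D: "to_plane D \<in> plane_line P ?v"
    using assms(1) by (auto simp: lsin_point_def unit_lines_def is_arg_min_def)
  obtain t where t: "t \<ge> 0" "Q = to_plane Y + t *\<^sub>R (to_plane Z - to_plane Y)"
    using Q by (auto simp: plane_ray_def)
  obtain s where s: "Q = to_plane P + s *\<^sub>R to_plane ?v"
    using Q by (auto simp: plane_line_def)
  \<comment> \<open>This extends \<open>det2 ?v (R - Y)\<close> to real points \<open>R\<close>; it
    is evaluated at \<open>Q\<close> once along the line and once along the ray.\<close>
  let ?Q = "\<lambda>R. real_of_int (fst ?v) * (snd R - real_of_int (snd Y))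
      - real_of_int (snd ?v) * (fst R - real_of_int (fst Y))"
  have "?Q Q = real_of_int (det2 ?v (P - Y))"
    unfolding s by (simp add: det2_def to_plane_def algebra_simps)
  moreover have "?Q Q = t * real_of_int (det2 ?v (Z - Y))"
    unfolding t by (simp add: det2_def to_plane_def algebra_simps)
  ultimately have "real_of_int (det2 ?v (P - Y)) = t * real_of_int (det2 ?v (Z - Y))"
    by simp
  then have "sgn (real_of_int (det2 ?v (P - Y))) = sgn t * sgn (real_of_int (det2 ?v (Z - Y)))"
    by (simp add: sgn_mult)
  moreover have PP: "\<bar>det2 ?v (P - Y)\<bar> = 1"
    using P by (simp add: lattice_basis_iff_det2)
  ultimately have "sgn (det2 ?v (P - Y)) = sgn (det2 ?v (Z - Y))"
    using t(1) assms(2) by (auto simp: sgn_if split: if_splits)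
  then show ?thesis
    using PP plane_line_det2[OF D, of Y] by (auto simp: sgn_if split: if_splits)
qed

text \<open>Ensures that the definite description in \<open>lsin\<close> is satisfied by some
  value.\<close>

lemma lsin_point_exists:
  assumes "X \<noteq> Y" "det2 (X - Y) (Z - Y) \<noteq> 0"
  obtains D where "lsin_point X Y Z D"
proof -
  let ?v = "prim_vec Y X"
  obtain k where k: "k > 0" "primitive ?v" "X - Y = lscale k ?v"
    using prim_vec_exists assms(1) by metis
  define d where "d = det2 ?v (Z - Y)"
  have d: "d \<noteq> 0"
    using assms(2) unfolding k(3) d_def by (simp add: det2_lscale_left)
  \<comment> \<open>The sign of \<open>d\<close> selects, among the two unit lines, the one on the
    same side of \<open>YX\<close> as \<open>Z\<close>.\<close>
  obtain p where p: "det2 ?v p = sgn d"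
    using primitive_det2_exists k(2) by blast
  define P where "P = Y + p"
  have PY: "det2 ?v (P - Y) = sgn d"
    by (simp add: P_def p)
  define l where "l = plane_line P ?v"
  have l: "l \<in> unit_lines X Y"
  proof -
    have "lattice_basis ?v (P - Y)"
      using PY d by (simp add: lattice_basis_iff_det2 abs_sgn_eq)
    then show ?thesis
      unfolding unit_lines_def l_def by blast
  qed
  \<comment> \<open>The determinant functional is \<open>d\<close> at \<open>Z\<close> and 0 at
    \<open>Y\<close>, so the factor \<open>1 / \<bar>d\<bar>\<close> brings it to
    \<open>sgn d\<close>, its value on \<open>l\<close>.\<close>
  define Q where "Q = to_plane Y + (1 / \<bar>real_of_int d\<bar>) *\<^sub>R (to_plane Z - to_plane Y)"
  have "to_plane ?v \<noteq> 0"
    using primitive_nonzero[OF k(2)] by (auto simp: to_plane_def prod_eq_iff)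
  moreover have "fst (to_plane ?v) * snd (Q - to_plane P) = snd (to_plane ?v) * fst (Q - to_plane P)"
  proof -
    have "fst (to_plane ?v) * snd (Q - to_plane P) - snd (to_plane ?v) * fst (Q - to_plane P)
      = (1 / \<bar>real_of_int d\<bar>) * real_of_int d - real_of_int (det2 ?v (P - Y))"
    proof -
      have d_real: "real_of_int d = fst (to_plane ?v) * (snd (to_plane Z) - snd (to_plane Y))
        - snd (to_plane ?v) * (fst (to_plane Z) - fst (to_plane Y))"
        by (simp add: d_def det2_def to_plane_def)
      have "b * real_of_int d = fst (to_plane ?v) * (b * (snd (to_plane Z) - snd (to_plane Y)))
        - snd (to_plane ?v) * (b * (fst (to_plane Z) - fst (to_plane Y)))" for b
        unfolding d_real by (simp add: algebra_simps)
      moreover have "real_of_int (det2 ?v (P - Y)) =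
          fst (to_plane ?v) * (snd (to_plane P) - snd (to_plane Y))
          - snd (to_plane ?v) * (fst (to_plane P) - fst (to_plane Y))"
        by (simp add: det2_def to_plane_def)
      ultimately show ?thesis
        by (simp add: Q_def right_diff_distrib distrib_left)
    qed
    also have "\<dots> = 0"
      using d unfolding PY by (auto simp: sgn_if abs_if)
    finally show ?thesis by simp
  qed
  ultimately obtain s where "Q - to_plane P = s *\<^sub>R to_plane ?v"
    using parallel_real_multiple by blast
  then have "Q = to_plane P + s *\<^sub>R to_plane ?v"
    by (simp add: algebra_simps)
  then have Q: "Q \<in> plane_ray Y Z \<inter> l"
    unfolding l_def plane_line_def plane_ray_def Q_def
    by (auto intro!: exI[of _ "1 / \<bar>real_of_int d\<bar>"])
  \<comment> \<open>Each step by \<open>- ?v\<close> along \<open>l\<close> subtracts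
    \<open>d\<close> from the determinant with \<open>Z - Y\<close>. After
    \<open>\<bar>c\<bar> + 1\<close> steps the initial value \<open>c\<close> is outweighed, so
    \<open>R\<close> lies across \<open>YZ\<close> from \<open>X\<close>.\<close>
  define c where "c = det2 (P - Y) (Z - Y)"
  define R where "R = P + lscale (- (\<bar>c\<bar> + 1)) ?v"
  have "det2 (R - Y) (Z - Y) = c - (\<bar>c\<bar> + 1) * d"
    unfolding R_def c_def d_def by (simp add: det2_def lscale_def algebra_simps)
  moreover have "sgn (c - (\<bar>c\<bar> + 1) * d) = - sgn d"
  proof (cases "d > 0")
    case True
    have "c < (\<bar>c\<bar> + 1) * 1"
      by simp
    also have "\<dots> \<le> (\<bar>c\<bar> + 1) * d"
      using True by (intro mult_left_mono) auto
    finally show ?thesis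
      using True by simp
  next
    case False
    then have "(\<bar>c\<bar> + 1) * d \<le> (\<bar>c\<bar> + 1) * (- 1)"
      using d by (intro mult_left_mono) auto
    also have "\<dots> < c"
      by simp
    finally show ?thesis
      using False d by simp
  qed
  moreover have "sgn3 X Y Z = sgn d"
    using k(1) unfolding sgn3_def k(3) d_def by (simp add: det2_lscale_left sgn_mult)
  ultimately have "sgn3 R Y Z = - sgn3 X Y Z"
    by (simp add: sgn3_def)
  moreover have "to_plane R \<in> l"
    unfolding l_def R_def plane_line_def to_plane_add to_plane_lscale by blast
  ultimately obtain D where "is_arg_min (\<lambda>P. dist (to_plane P) Q)
      (\<lambda>P. to_plane P \<in> l \<and> sgn3 P Y Z = - sgn3 X Y Z) D"
    using nearest_lattice_point_exists[of "\<lambda>P. to_plane P \<in> l \<and> sgn3 P Y Z = - sgn3 X Y Z" R]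
    by blast
  then show ?thesis
    using that l Q unfolding lsin_point_def by blast
qed

text \<open>Taking the determinant with \<open>prim_vec Y X\<close> removes the \<open>x1\<close>
  term from the defining equation and leaves \<open>x2\<close> times the sign of
  \<open>det2 ?v ?w\<close>, whichever admissible \<open>D\<close> was chosen.\<close>

theorem lsin_eq_abs_det2:
  assumes "det2 (X - Y) (Z - Y) \<noteq> 0"
  shows "lsin X Y Z = \<bar>det2 (prim_vec Y X) (prim_vec Y Z)\<bar>"
proof -
  let ?v = "prim_vec Y X" and ?w = "prim_vec Y Z"
  have "X \<noteq> Y" "Z \<noteq> Y"
    using assms by (auto simp: det2_def)
  then obtain k m where k: "k > 0" "X - Y = lscale k ?v" and m: "m > 0" "Z - Y = lscale m ?w"
    using prim_vec_exists by metis
  have vw: "det2 ?v ?w \<noteq> 0"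
    using assms unfolding k(2) m(2) by (simp add: det2_lscale_left det2_lscale_right)
  then have vZ: "det2 ?v (Z - Y) \<noteq> 0" and
    sgn: "sgn (det2 ?v (Z - Y)) = sgn (det2 ?v ?w)"
    using m unfolding m(2) by (simp_all add: det2_lscale_right sgn_mult)
  have D: "det2 ?v (D - Y) = sgn (det2 ?v ?w)" if "lsin_point X Y Z D" for D
    using lsin_point_det2[OF that vZ] sgn by simp
  show ?thesis
    unfolding lsin_def
  proof (rule the_equality)
    obtain D where DD: "lsin_point X Y Z D"
      using lsin_point_exists \<open>X \<noteq> Y\<close> assms by blast
    have "lattice_basis ?v (D - Y)"
      using D[OF DD] vw by (simp add: lattice_basis_iff_det2 abs_sgn_eq)
    then obtain x1 x2 where x: "?w = lscale x1 ?v + lscale x2 (D - Y)"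
      unfolding lattice_basis_def by blast
    have "det2 ?v ?w = x2 * det2 ?v (D - Y)"
      by (subst x) (simp add: det2_add_right det2_lscale_right)
    then have "x2 = \<bar>det2 ?v ?w\<bar>"
      using D[OF DD] vw by (auto simp: sgn_if abs_if split: if_splits)
    then show "\<exists>D x1. lsin_point X Y Z D \<and>
        ?w = lscale x1 ?v + lscale \<bar>det2 ?v ?w\<bar> (D - Y)"
      using DD x by blast
  next
    fix x2
    assume "\<exists>D x1. lsin_point X Y Z D \<and> ?w = lscale x1 ?v + lscale x2 (D - Y)"
    then obtain D x1 where DD: "lsin_point X Y Z D" and x: "?w = lscale x1 ?v + lscale x2 (D - Y)"
      by blast
    have "det2 ?v ?w = x2 * det2 ?v (D - Y)"
      by (subst x) (simp add: det2_add_right det2_lscale_right)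
    then show "x2 = \<bar>det2 ?v ?w\<bar>"
      using D[OF DD] vw by (auto simp: sgn_if abs_if split: if_splits)
  qed
qed

lemma collinear_if_det2_eq_0:
  assumes "det2 (X - Y) (Z - Y) = 0"
  shows "collinear {to_plane X, to_plane Y, to_plane Z}"
proof -
  have "collinear {0, to_plane (X - Y), to_plane (Z - Y)}"
  proof (cases "to_plane (X - Y) = 0")
    case False
    moreover have "fst (to_plane (X - Y)) * snd (to_plane (Z - Y))
        = snd (to_plane (X - Y)) * fst (to_plane (Z - Y))"
      using assms unfolding to_plane_def det2_def
      by (simp flip: of_int_mult of_int_diff)
    ultimately show ?thesis
      using parallel_real_multiple by (metis collinear_lemma)
  qed (simp add: collinear_lemma)
  then show ?thesis
    unfolding to_plane_diff by (subst collinear_3) (simp_all add: NO_MATCH_def)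
qed

section \<open>Continuants and extended continued fractions\<close>

text \<open>Numerator and denominator of the continued fraction, kept as integers so that infinite
  intermediate values need no division. The empty list stands for 1/0, the neutral tail.\<close>

fun continuant_pair :: "int list \<Rightarrow> int \<times> int" where
  "continuant_pair [] = (1, 0)"
| "continuant_pair (a # as) =
     (a * fst (continuant_pair as) + snd (continuant_pair as), fst (continuant_pair as))"

lemma continuant_pair_nonzero: "continuant_pair as \<noteq> (0, 0)"
  by (induction as) (auto simp: prod_eq_iff)

text \<open>The pair (0, 0) must be excluded: \<open>ext_quotient 0 0\<close> is
  \<open>Infty\<close>, whose inverse is \<open>Fin 0\<close>.\<close>

lemma inverse_ext_quotient:
  assumes "(q, p) \<noteq> (0, 0)"
  shows "inverse_ext (ext_quotient q p) = ext_quotient p q"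
  using assms by (auto simp: ext_quotient_def)

lemma add_ext_quotient: "add_ext (of_int a) (ext_quotient q p) = ext_quotient (a * p + q) p"
  by (simp add: ext_quotient_def field_simps)

lemma cont_frac_eq_continuants:
  "as \<noteq> [] \<Longrightarrow>
    cont_frac as = ext_quotient (fst (continuant_pair as)) (snd (continuant_pair as))"
proof (induction as rule: cont_frac.induct)
  case (1 a)
  then show ?case
    by (simp add: ext_quotient_def)
next
  case (2 a b bs)
  have "inverse_ext (cont_frac (b # bs)) =
      ext_quotient (snd (continuant_pair (b # bs))) (fst (continuant_pair (b # bs)))"
    using continuant_pair_nonzero[of "b # bs"] 2
    by (simp only: inverse_ext_quotient prod.collapse list.distinct simp_thms)
  then show ?case
    by (simp only: cont_frac.simps add_ext_quotient continuant_pair.simps(2)[of a] fst_conv snd_conv)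
qed simp

text \<open>Continuants unfold at the head of the list while \<open>r\<close> advances at the other
  end. The induction therefore shifts \<open>f\<close> and \<open>r\<close> by one, expressing the
  last vector through \<open>r 1\<close> and \<open>r 2\<close>, and then eliminates
  \<open>r 2\<close>.\<close>

lemma continuant_pair_recurrence:
  assumes "\<And>k. k < m \<Longrightarrow> r (k + 2) = r k + lscale (f k) (r (k + 1))"
  shows "r (m + 1) = lscale (snd (continuant_pair (map f [0..<m]))) (r 0)
    + lscale (fst (continuant_pair (map f [0..<m]))) (r 1)"
  using assms
proof (induction m arbitrary: f r)
  case 0
  show ?case
    by (simp add: lscale_def prod_eq_iff)
next
  case (Suc m)
  have r2: "r 2 = r 0 + lscale (f 0) (r 1)"
    using Suc.prems[of 0] by (simp add: numeral_2_eq_2)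
  have "r (Suc (m + 1)) = lscale (snd (continuant_pair (map (\<lambda>k. f (Suc k)) [0..<m]))) (r (Suc 0))
      + lscale (fst (continuant_pair (map (\<lambda>k. f (Suc k)) [0..<m]))) (r (Suc 1))"
    by (rule Suc.IH) (use Suc.prems[of "Suc _"] in simp)
  moreover have "map f [0..<Suc m] = f 0 # map (\<lambda>k. f (Suc k)) [0..<m]"
    by (rule map_upt_Suc)
  ultimately show ?case
    by (simp add: r2 numeral_2_eq_2[symmetric] lscale_def prod_eq_iff algebra_simps del: upt_Suc)
qed

section \<open>The recurrence along a broken line at unit distance\<close>

text \<open>The vector \<open>u\<^sub>i\<close>: the primitive vector along \<open>A\<^sub>i\<^sub>-\<^sub>1A\<^sub>i\<close>, oriented counterclockwise around the
  origin.\<close>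

definition signed_dir :: "(nat \<Rightarrow> lattice_point) \<Rightarrow> nat \<Rightarrow> lattice_point" where
  "signed_dir A i =
     lscale (det2 (A (i - 1)) (prim_vec (A (i - 1)) (A i))) (prim_vec (A (i - 1)) (A i))"

locale unit_broken_line =
  fixes n :: nat and A :: "nat \<Rightarrow> lattice_point"
  assumes broken: "broken_line n A" and unit: "on_unit_distance (0, 0) n A"
begin

abbreviation "w i \<equiv> prim_vec (A (i - 1)) (A i)"

lemma segment:
  assumes "i \<in> {1..n}"
  defines "L \<equiv> lattice_length (A (i - 1)) (A i)"
  shows "L > 0" "A i - A (i - 1) = lscale L (w i)" "primitive (w i)"
proof -
  have "A (i - 1) \<noteq> A i"
    using broken assms by (auto simp: broken_line_def)
  then obtain k where k: "k > 0" "primitive (w i)" "A i - A (i - 1) = lscale k (w i)"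
    using prim_vec_exists by blast
  then show "L > 0" "A i - A (i - 1) = lscale L (w i)" "primitive (w i)"
    using lattice_length_lscale[OF k(2,1,3)] by (simp_all add: L_def)
qed

lemma abs_det2_unit:
  assumes "i \<in> {1..n}"
  shows "\<bar>det2 (A (i - 1)) (w i)\<bar> = 1"
proof -
  have "\<bar>det2 (w i) ((0, 0) - A (i - 1))\<bar> = 1"
    using unit assms unfolding on_unit_distance_def lattice_basis_iff_det2 by blast
  moreover have "det2 (w i) ((0, 0) - A (i - 1)) = det2 (A (i - 1)) (w i)"
    by (simp add: det2_def)
  ultimately show ?thesis by simp
qed

lemma det2_segment:
  assumes "i \<in> {1..n}"
  shows "det2 (A (i - 1)) (A i) =
    lattice_length (A (i - 1)) (A i) * det2 (A (i - 1)) (w i)"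
proof -
  have "A i = A (i - 1) + lscale (lattice_length (A (i - 1)) (A i)) (w i)"
    using segment(2)[OF assms] by (metis add.commute diff_add_cancel)
  then show ?thesis
    by (metis add_0 det2_add_right det2_lscale_right det2_self)
qed

text \<open>The determinant of the two endpoints is the positive lattice length times a determinant
  equal to 1 or -1.\<close>

lemma sgn3_origin:
  assumes "i \<in> {1..n}"
  shows "sgn3 (A (i - 1)) (0, 0) (A i) = det2 (A (i - 1)) (w i)"
proof -
  have "sgn3 (A (i - 1)) (0, 0) (A i) = sgn (det2 (A (i - 1)) (A i))"
    by (simp add: sgn3_def zero_prod_def[symmetric])
  then show ?thesis
    using segment(1)[OF assms] abs_det2_unit[OF assms] unfolding det2_segment[OF assms]
    by (simp add: sgn_mult) (metis sgn_mult_abs mult.right_neutral)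
qed

text \<open>The orientation sign enters once through \<open>lsls_even\<close> and once through
  \<open>signed_dir\<close>, so it squares to 1.\<close>

lemma point_step:
  assumes "i \<in> {1..n}"
  shows "A i = A (i - 1) + lscale (lsls_even (0, 0) A i) (signed_dir A i)"
proof -
  let ?L = "lattice_length (A (i - 1)) (A i)" and ?e = "det2 (A (i - 1)) (w i)"
  have e: "?e * ?e = 1"
    using abs_det2_unit[OF assms] by (auto simp: abs_if split: if_splits)
  have "lscale (lsls_even (0, 0) A i) (signed_dir A i) = lscale (?L * (?e * ?e)) (w i)"
    unfolding lsls_even_def sgn3_origin[OF assms] signed_dir_def
    by (simp add: lscale_def algebra_simps)
  then have "lscale (lsls_even (0, 0) A i) (signed_dir A i) = A i - A (i - 1)"
    using e segment(2)[OF assms] by simp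
  then show ?thesis
    by simp
qed

lemma det2_start_dir:
  assumes "i \<in> {1..n}"
  shows "det2 (A (i - 1)) (signed_dir A i) = 1"
  using abs_det2_unit[OF assms]
  by (auto simp: signed_dir_def det2_lscale_right abs_if split: if_splits)

text \<open>Moving along the segment adds a multiple of \<open>signed_dir A i\<close>, which leaves
  this determinant unchanged.\<close>

lemma det2_end_dir:
  assumes "i \<in> {1..n}"
  shows "det2 (A i) (signed_dir A i) = 1"
proof -
  have "det2 (A i) (signed_dir A i) = det2 (A (i - 1)) (signed_dir A i)"
    by (subst point_step[OF assms]) (simp add: det2_add_left det2_lscale_left)
  then show ?thesis
    using det2_start_dir[OF assms] by simp
qed

text \<open>The sign of the turn restores the sign lost in the lattice sine, and the two signs at
  the origin turn the primitive vectors into signed directions.\<close>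

lemma lsls_odd_eq_det2:
  assumes "i \<in> {1..<n}"
  shows "lsls_odd (0, 0) A i = det2 (signed_dir A (i + 1)) (signed_dir A i)"
proof -
  have i: "i \<in> {1..n}" "i + 1 \<in> {1..n}"
    using assms by auto
  let ?L = "lattice_length (A (i - 1)) (A i)" and ?M = "lattice_length (A i) (A (i + 1))"
  have M: "?M > 0" "A (i + 1) - A i = lscale ?M (w (i + 1))"
    using segment[OF i(2)] by simp_all
  have L: "A (i - 1) - A i = lscale ?L (- w i)"
    using segment(2)[OF i(1)] by (simp add: lscale_def prod_eq_iff)
  have "\<not> collinear {to_plane (A (i - 1)), to_plane (A i), to_plane (A (i + 1))}"
    using broken assms by (auto simp: broken_line_def)
  then have nz: "det2 (A (i - 1) - A i) (A (i + 1) - A i) \<noteq> 0"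
    using collinear_if_det2_eq_0 by blast
  have "primitive (- w i)"
    using segment(3)[OF i(1)] by (simp add: primitive_def)
  \<comment> \<open>The first side of the angle at \<open>A i\<close> points back to
    \<open>A (i - 1)\<close>; the resulting minus sign is later absorbed by exchanging the arguments
    of \<open>det2\<close>.\<close>
  then have reversed: "prim_vec (A i) (A (i - 1)) = - w i"
    using prim_vec_eqI segment(1)[OF i(1)] L by blast
  have sine: "lsin (A (i - 1)) (A i) (A (i + 1)) = \<bar>det2 (- w i) (w (i + 1))\<bar>"
    using lsin_eq_abs_det2[OF nz] unfolding reversed by simp
  have "sgn3 (A (i - 1)) (A i) (A (i + 1)) = sgn (det2 (- w i) (w (i + 1)))"
    unfolding sgn3_def L M(2) using segment(1)[OF i(1)] M(1)
    by (simp add: det2_lscale_left det2_lscale_right sgn_mult)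
  then have "sgn3 (A (i - 1)) (A i) (A (i + 1)) * lsin (A (i - 1)) (A i) (A (i + 1))
      = det2 (- w i) (w (i + 1))"
    unfolding sine by (simp add: sgn_mult_abs)
  then have "lsls_odd (0, 0) A i =
      det2 (A (i - 1)) (w i) * det2 (A i) (w (i + 1)) * det2 (- w i) (w (i + 1))"
    using sgn3_origin[OF i(1)] sgn3_origin[OF i(2)] unfolding lsls_odd_def
    by (simp add: mult.assoc)
  also have "\<dots> = det2 (signed_dir A (i + 1)) (signed_dir A i)"
    unfolding signed_dir_def det2_lscale_left det2_lscale_right
      det2_swap[of "w (i + 1)" "w i"]
    by (simp add: det2_def algebra_simps)
  finally show ?thesis .
qed

text \<open>Cramer's rule in the basis \<open>A i\<close>, \<open>signed_dir A i\<close> of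
  determinant 1. The coefficient of \<open>signed_dir A i\<close> is 1 because segment
  \<open>i + 1\<close> starts at \<open>A i\<close>.\<close>

lemma dir_step:
  assumes "i \<in> {1..<n}"
  shows "signed_dir A (i + 1) = signed_dir A i + lscale (lsls_odd (0, 0) A i) (A i)"
proof -
  have i: "i \<in> {1..n}" "i + 1 \<in> {1..n}"
    using assms by auto
  have "lscale (det2 (A i) (signed_dir A i)) (signed_dir A (i + 1)) =
      lscale (det2 (signed_dir A (i + 1)) (signed_dir A i)) (A i)
      + lscale (det2 (A i) (signed_dir A (i + 1))) (signed_dir A i)"
    by (rule det2_cramer)
  then show ?thesis
    using det2_end_dir[OF i(1)] det2_start_dir[OF i(2)] lsls_odd_eq_det2[OF assms]
    by (simp add: lscale_def prod_eq_iff)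
qed

lemma endpoint_eq_continuants:
  defines "c \<equiv> continuant_pair (signed_length_sine (0, 0) n A)"
  shows "A n = lscale (snd c) (A 0) + lscale (fst c) (signed_dir A 1)"
proof -
  let ?f = "\<lambda>k. if even k then lsls_even (0, 0) A (k div 2 + 1)
    else lsls_odd (0, 0) A (k div 2 + 1)"
  \<comment> \<open>Points and directions are interleaved as \<open>A 0\<close>,
    \<open>signed_dir A 1\<close>, \<open>A 1\<close>, \<open>signed_dir A 2\<close> and so on,
    which merges both step rules into one recurrence ending with \<open>A n\<close> at index
    \<open>2 * n\<close>.\<close>
  let ?r = "\<lambda>k. if even k then A (k div 2) else signed_dir A (k div 2 + 1)"
  have n: "n \<ge> 1"
    using broken by (simp add: broken_line_def)
  have "?r (2 * n - 1 + 1) =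
      lscale (snd (continuant_pair (map ?f [0..<2 * n - 1]))) (?r 0)
      + lscale (fst (continuant_pair (map ?f [0..<2 * n - 1]))) (?r 1)"
  proof (rule continuant_pair_recurrence)
    fix k assume k: "k < 2 * n - 1"
    show "?r (k + 2) = ?r k + lscale (?f k) (?r (k + 1))"
    proof (cases "even k")
      case True
      then have "k div 2 + 1 \<in> {1..n}"
        using k by auto
      from point_step[OF this] show ?thesis
        using True by simp
    next
      case False
      then obtain j where j: "k = 2 * j + 1"
        by (auto elim: oddE)
      then have "j + 1 \<in> {1..<n}"
        using k by auto
      from dir_step[OF this] show ?thesis
        by (simp add: j)
    qed
  qed
  moreover have "2 * n - 1 + 1 = 2 * n"
    using n by simp
  ultimately show ?thesis
    unfolding c_def signed_length_sine_def by simp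
qed

end

theorem theorem3p5:
  fixes n :: nat and A :: "nat \<Rightarrow> lattice_point" and a :: "int list" and p q :: int
  assumes "broken_line n A"
    and "on_unit_distance (0, 0) n A"
    and "a = signed_length_sine (0, 0) n A"
    and "A 0 = (1, 0)"
    and "A 1 = (1, a ! 0)"
    and "A n = (p, q)"
    and "gcd p q = 1"
  shows "ext_quotient q p = cont_frac a"
proof -
  interpret unit_broken_line n A
    using assms by unfold_locales
  have n: "n \<ge> 1"
    using assms(1) by (simp add: broken_line_def)
  then have one: "1 \<in> {1..n}"
    by simp
  define u where "u = signed_dir A 1"
  have "snd u = 1"
    using det2_start_dir[OF one] assms(4) by (simp add: u_def det2_def)
  moreover have "fst u = 0"
  proof -
    have "det2 (A 1) u = 1"
      using det2_end_dir[OF one] by (simp add: u_def)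
    \<comment> \<open>With \<open>A 1 = (1, a ! 0)\<close> and \<open>snd u = 1\<close>, the
      determinant condition becomes \<open>a ! 0 * fst u = 0\<close>; the first factor is nonzero
      because \<open>A 0\<close> and \<open>A 1\<close> differ.\<close>
    moreover have "a ! 0 \<noteq> 0"
      using assms(1,4,5) one unfolding broken_line_def by (metis diff_self_eq_0)
    ultimately show ?thesis
      using assms(5) \<open>snd u = 1\<close> by (simp add: det2_def)
  qed
  \<comment> \<open>As \<open>A 0\<close> and \<open>u\<close> are the standard basis vectors, the
    coordinates of \<open>A n\<close> are the denominator and the numerator themselves.\<close>
  ultimately have "(p, q) = (snd (continuant_pair a), fst (continuant_pair a))"
    using endpoint_eq_continuants unfolding assms(3,4,6) u_def[symmetric]
    by (simp add: lscale_def)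
  moreover have "a \<noteq> []"
    using n assms(3) by (simp add: signed_length_sine_def)
  ultimately show ?thesis
    using cont_frac_eq_continuants by simp
qed

end
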